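(* Let $(M,g,\nabla,\nabla^{\star})$ be a statistical manifold and let $\{\nabla^{\alpha}\}_{\alpha\in\mathbb{R}}$ be its family of $\alpha$-connections. If $\nabla^{\alpha}$ is regularly metric for every positive real number $\alpha$, then $\nabla^{\alpha}$ is regularly metric for every $\alpha\in\mathbb{R}$.
   Context: All objects are $C^\infty$. A statistical manifold $(M,g,\nabla,\nabla^{\star})$ is a finite dimensional manifold $M$ with a Riemannian metric $g$ and two torsion-free linear connections $\nabla,\nabla^{\star}$ in $TM$ that are dual with respect to $g$: $X(g(Y,Z))=g(\nabla_XY,Z)+g(Y,\nabla^{\star}_XZ)$ for all vector fields $X,Y,Z$. Its $\alpha$-connections are $\nabla^{\alpha}=\frac{1+\alpha}{2}\nabla+\frac{1-\alpha}{2}\nabla^{\star}$, $\alpha\in\mathbb{R}$. A linear connection $D$ in $TM$ is called regularly metric if there exists a nondegenerate (of any signature) symmetric bilinear form $h$ on $TM$ with $Dh=0$. *)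

theory Defs
  imports "HOL-Analysis.Analysis"
begin

(* The model space is any finite-dimensional type of class real_inner. The class euclidean_space
   is avoided because it excludes dimension 0. *)

definition finite_dim :: "'e::real_vector itself \<Rightarrow> bool" where
  "finite_dim _ \<longleftrightarrow> (\<exists>B::'e set. finite B \<and> span B = UNIV)"

section \<open>Smooth maps between normed spaces\<close>

(* Meant for open S and a finite-dimensional domain; continuity of the derivative in every
   fixed direction is then the same as continuity in operator norm. *)
primrec Ck_on :: "nat \<Rightarrow> 'a::real_normed_vector set \<Rightarrow> ('a \<Rightarrow> 'b::real_normed_vector) \<Rightarrow> bool" where
  "Ck_on 0 S f \<longleftrightarrow> continuous_on S f"
| "Ck_on (Suc k) S f \<longleftrightarrow>
     (\<forall>x\<in>S. f differentiable (at x)) \<and> (\<forall>v. Ck_on k S (\<lambda>x. frechet_derivative f (at x) v))"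

definition smooth_on :: "'a::real_normed_vector set \<Rightarrow> ('a \<Rightarrow> 'b::real_normed_vector) \<Rightarrow> bool" where
  "smooth_on S f \<longleftrightarrow> (\<forall>k. Ck_on k S f)"

section \<open>Smooth manifolds\<close>

(* A chart is its domain together with the coordinate map; values of the map outside the domain
   are irrelevant. *)
type_synonym ('m, 'e) chart = "'m set \<times> ('m \<Rightarrow> 'e)"

abbreviation chart_dom :: "('m, 'e) chart \<Rightarrow> 'm set" where
  "chart_dom \<equiv> fst"

abbreviation chart_map :: "('m, 'e) chart \<Rightarrow> 'm \<Rightarrow> 'e" where
  "chart_map \<equiv> snd"

definition chart_inv :: "('m, 'e) chart \<Rightarrow> 'e \<Rightarrow> 'm" where
  "chart_inv c = inv_into (chart_dom c) (chart_map c)"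

definition chart_image :: "('m, 'e) chart \<Rightarrow> 'e set" where
  "chart_image c = chart_map c ` chart_dom c"

definition is_chart :: "('m::topological_space, 'e::real_normed_vector) chart \<Rightarrow> bool" where
  "is_chart c \<longleftrightarrow> open (chart_dom c) \<and> open (chart_image c) \<and>
     homeomorphism (chart_dom c) (chart_image c) (chart_map c) (chart_inv c)"

definition transition :: "('m, 'e) chart \<Rightarrow> ('m, 'e) chart \<Rightarrow> 'e \<Rightarrow> 'e" where
  "transition c c' = chart_map c' \<circ> chart_inv c"

(* The manifold is the whole type 'm; A is any smooth atlas (not necessarily maximal) of its
   smooth structure. *)
definition smooth_manifold ::
    "('m::{t2_space, second_countable_topology}, 'e::real_inner) chart set \<Rightarrow> bool" where
  "smooth_manifold A \<longleftrightarrow>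
     finite_dim TYPE('e) \<and>
     (\<forall>c\<in>A. is_chart c) \<and>
     \<Union> (chart_dom ` A) = UNIV \<and>
     (\<forall>c\<in>A. \<forall>c'\<in>A. smooth_on (chart_map c ` (chart_dom c \<inter> chart_dom c')) (transition c c'))"

definition charts_at :: "('m, 'e) chart set \<Rightarrow> 'm \<Rightarrow> ('m, 'e) chart set" where
  "charts_at A p = {c \<in> A. p \<in> chart_dom c}"

definition smooth_fun ::
    "('m, 'e::real_normed_vector) chart set \<Rightarrow> ('m \<Rightarrow> real) \<Rightarrow> bool" where
  "smooth_fun A f \<longleftrightarrow> (\<forall>c\<in>A. smooth_on (chart_image c) (\<lambda>x. f (chart_inv c x)))"

section \<open>Tangent vectors and vector fields\<close>

(* A tangent vector at p is the family of its coordinate vectors in all charts at p, related by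
   the derivatives of the transition maps. Entries for other charts are set to 0, so that
   equality of such families is equality of tangent vectors. Sums and scalar multiples are
   formed componentwise. *)
type_synonym ('m, 'e) tvec = "('m, 'e) chart \<Rightarrow> 'e"

definition tangent_space ::
    "('m, 'e::real_normed_vector) chart set \<Rightarrow> 'm \<Rightarrow> ('m, 'e) tvec set" where
  "tangent_space A p = {v.
     (\<forall>c\<in>charts_at A p. \<forall>c'\<in>charts_at A p.
        v c' = frechet_derivative (transition c c') (at (chart_map c p)) (v c)) \<and>
     (\<forall>c. c \<notin> charts_at A p \<longrightarrow> v c = 0)}"

(* The tangent vector at p whose coordinate vector in the chart c is v, i.e. the value at p of
   the coordinate field of c in direction v. *)
definition coord_vec ::
    "('m, 'e::real_normed_vector) chart set \<Rightarrow> ('m, 'e) chart \<Rightarrow> 'm \<Rightarrow> 'e \<Rightarrow> ('m, 'e) tvec" where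
  "coord_vec A c p v = (\<lambda>c'. if c' \<in> charts_at A p
     then frechet_derivative (transition c c') (at (chart_map c p)) v else 0)"

type_synonym ('m, 'e) vfield = "'m \<Rightarrow> ('m, 'e) tvec"

definition vf_rep :: "('m, 'e) chart \<Rightarrow> ('m, 'e) vfield \<Rightarrow> 'e \<Rightarrow> 'e" where
  "vf_rep c X = (\<lambda>x. X (chart_inv c x) c)"

definition smooth_vfields ::
    "('m, 'e::real_normed_vector) chart set \<Rightarrow> ('m, 'e) vfield set" where
  "smooth_vfields A = {X. (\<forall>p. X p \<in> tangent_space A p) \<and>
     (\<forall>c\<in>A. smooth_on (chart_image c) (vf_rep c X))}"

definition vf_add ::
    "('m, 'e::real_vector) vfield \<Rightarrow> ('m, 'e) vfield \<Rightarrow> ('m, 'e) vfield" where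
  "vf_add X Y = (\<lambda>p c. X p c + Y p c)"

definition vf_scale ::
    "('m \<Rightarrow> real) \<Rightarrow> ('m, 'e::real_vector) vfield \<Rightarrow> ('m, 'e) vfield" where
  "vf_scale f X = (\<lambda>p c. f p *\<^sub>R X p c)"

(* The function X(f); the value does not depend on the chart chosen at p. *)
definition vf_apply ::
    "('m, 'e::real_normed_vector) chart set \<Rightarrow> ('m, 'e) vfield \<Rightarrow> ('m \<Rightarrow> real) \<Rightarrow> 'm \<Rightarrow> real" where
  "vf_apply A X f p = (let c = (SOME c. c \<in> charts_at A p) in
     frechet_derivative (\<lambda>x. f (chart_inv c x)) (at (chart_map c p)) (X p c))"

(* In a chart, [X,Y] = DY(X) - DX(Y). *)
definition lie_bracket ::
    "('m, 'e::real_normed_vector) chart set \<Rightarrow> ('m, 'e) vfield \<Rightarrow> ('m, 'e) vfield \<Rightarrow> ('m, 'e) vfield" where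
  "lie_bracket A X Y = (\<lambda>p c. if c \<in> charts_at A p
     then frechet_derivative (vf_rep c Y) (at (chart_map c p)) (X p c)
        - frechet_derivative (vf_rep c X) (at (chart_map c p)) (Y p c)
     else 0)"

section \<open>Symmetric bilinear forms on the tangent bundle\<close>

(* Only the values of h p on the tangent space at p are meaningful. *)
type_synonym ('m, 'e) tform = "'m \<Rightarrow> ('m, 'e) tvec \<Rightarrow> ('m, 'e) tvec \<Rightarrow> real"

(* Bilinearity in the second argument follows from symmetry; smoothness means smoothness of
   the components with respect to the coordinate fields of every chart. *)
definition smooth_sym_form ::
    "('m, 'e::real_normed_vector) chart set \<Rightarrow> ('m, 'e) tform \<Rightarrow> bool" where
  "smooth_sym_form A h \<longleftrightarrow>
     (\<forall>p. \<forall>u\<in>tangent_space A p. \<forall>v\<in>tangent_space A p. h p u v = h p v u) \<and>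
     (\<forall>p. \<forall>u\<in>tangent_space A p. \<forall>v\<in>tangent_space A p. \<forall>w\<in>tangent_space A p. \<forall>a b.
        h p (\<lambda>c. a *\<^sub>R u c + b *\<^sub>R v c) w = a * h p u w + b * h p v w) \<and>
     (\<forall>c\<in>A. \<forall>v w. smooth_on (chart_image c)
        (\<lambda>x. h (chart_inv c x) (coord_vec A c (chart_inv c x) v) (coord_vec A c (chart_inv c x) w)))"

definition nondegenerate ::
    "('m, 'e::real_normed_vector) chart set \<Rightarrow> ('m, 'e) tform \<Rightarrow> bool" where
  "nondegenerate A h \<longleftrightarrow>
     (\<forall>p. \<forall>u\<in>tangent_space A p. (\<forall>v\<in>tangent_space A p. h p u v = 0) \<longrightarrow> u = (\<lambda>_. 0))"

definition riemannian_metric ::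
    "('m, 'e::real_normed_vector) chart set \<Rightarrow> ('m, 'e) tform \<Rightarrow> bool" where
  "riemannian_metric A g \<longleftrightarrow> smooth_sym_form A g \<and>
     (\<forall>p. \<forall>u\<in>tangent_space A p. u \<noteq> (\<lambda>_. 0) \<longrightarrow> g p u u > 0)"

section \<open>Linear connections\<close>

(* D X Y is the covariant derivative of Y in direction X; only its values on smooth vector
   fields are meaningful. *)
type_synonym ('m, 'e) conn = "('m, 'e) vfield \<Rightarrow> ('m, 'e) vfield \<Rightarrow> ('m, 'e) vfield"

definition linear_connection ::
    "('m, 'e::real_normed_vector) chart set \<Rightarrow> ('m, 'e) conn \<Rightarrow> bool" where
  "linear_connection A D \<longleftrightarrow>
     (\<forall>X\<in>smooth_vfields A. \<forall>Y\<in>smooth_vfields A. D X Y \<in> smooth_vfields A) \<and>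
     (\<forall>X\<in>smooth_vfields A. \<forall>X'\<in>smooth_vfields A. \<forall>Y\<in>smooth_vfields A.
        D (vf_add X X') Y = vf_add (D X Y) (D X' Y)) \<and>
     (\<forall>f. \<forall>X\<in>smooth_vfields A. \<forall>Y\<in>smooth_vfields A. smooth_fun A f \<longrightarrow>
        D (vf_scale f X) Y = vf_scale f (D X Y)) \<and>
     (\<forall>X\<in>smooth_vfields A. \<forall>Y\<in>smooth_vfields A. \<forall>Y'\<in>smooth_vfields A.
        D X (vf_add Y Y') = vf_add (D X Y) (D X Y')) \<and>
     (\<forall>f. \<forall>X\<in>smooth_vfields A. \<forall>Y\<in>smooth_vfields A. smooth_fun A f \<longrightarrow>
        D X (vf_scale f Y) = vf_add (vf_scale (vf_apply A X f) Y) (vf_scale f (D X Y)))"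

definition torsion_free ::
    "('m, 'e::real_normed_vector) chart set \<Rightarrow> ('m, 'e) conn \<Rightarrow> bool" where
  "torsion_free A D \<longleftrightarrow> (\<forall>X\<in>smooth_vfields A. \<forall>Y\<in>smooth_vfields A.
     vf_add (D X Y) (vf_scale (\<lambda>_. - 1) (D Y X)) = lie_bracket A X Y)"

definition dual_connections ::
    "('m, 'e::real_normed_vector) chart set \<Rightarrow> ('m, 'e) tform \<Rightarrow> ('m, 'e) conn \<Rightarrow> ('m, 'e) conn \<Rightarrow> bool" where
  "dual_connections A g D D' \<longleftrightarrow>
     (\<forall>X\<in>smooth_vfields A. \<forall>Y\<in>smooth_vfields A. \<forall>Z\<in>smooth_vfields A. \<forall>p.
        vf_apply A X (\<lambda>q. g q (Y q) (Z q)) p = g p (D X Y p) (Z p) + g p (Y p) (D' X Z p))"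

definition statistical_manifold ::
    "('m::{t2_space, second_countable_topology}, 'e::real_inner) chart set \<Rightarrow>
     ('m, 'e) tform \<Rightarrow> ('m, 'e) conn \<Rightarrow> ('m, 'e) conn \<Rightarrow> bool" where
  "statistical_manifold A g D D' \<longleftrightarrow>
     smooth_manifold A \<and> riemannian_metric A g \<and>
     linear_connection A D \<and> torsion_free A D \<and>
     linear_connection A D' \<and> torsion_free A D' \<and>
     dual_connections A g D D'"

definition alpha_connection ::
    "('m, 'e::real_vector) conn \<Rightarrow> ('m, 'e) conn \<Rightarrow> real \<Rightarrow> ('m, 'e) conn" where
  "alpha_connection D D' \<alpha> = (\<lambda>X Y.
     vf_add (vf_scale (\<lambda>_. (1 + \<alpha>) / 2) (D X Y)) (vf_scale (\<lambda>_. (1 - \<alpha>) / 2) (D' X Y)))"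

definition form_cov_deriv ::
    "('m, 'e::real_normed_vector) chart set \<Rightarrow> ('m, 'e) conn \<Rightarrow> ('m, 'e) tform \<Rightarrow>
     ('m, 'e) vfield \<Rightarrow> ('m, 'e) vfield \<Rightarrow> ('m, 'e) vfield \<Rightarrow> 'm \<Rightarrow> real" where
  "form_cov_deriv A D h X Y Z p =
     vf_apply A X (\<lambda>q. h q (Y q) (Z q)) p - h p (D X Y p) (Z p) - h p (Y p) (D X Z p)"

definition parallel_form ::
    "('m, 'e::real_normed_vector) chart set \<Rightarrow> ('m, 'e) conn \<Rightarrow> ('m, 'e) tform \<Rightarrow> bool" where
  "parallel_form A D h \<longleftrightarrow>
     (\<forall>X\<in>smooth_vfields A. \<forall>Y\<in>smooth_vfields A. \<forall>Z\<in>smooth_vfields A. \<forall>p.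
        form_cov_deriv A D h X Y Z p = 0)"

definition regularly_metric ::
    "('m, 'e::real_normed_vector) chart set \<Rightarrow> ('m, 'e) conn \<Rightarrow> bool" where
  "regularly_metric A D \<longleftrightarrow>
     (\<exists>h. smooth_sym_form A h \<and> nondegenerate A h \<and> parallel_form A D h)"

end

(* The connections nabla^alpha and nabla^(-alpha) are dual with respect to g, and nabla^0 is
   metric for g itself. If h(u,v) = g(K u,v) is nondegenerate and parallel for a connection,
   then duality makes K intertwine that connection with its dual, so g(K^-1 u,v) is parallel
   for the dual connection. Hence nabla^(-alpha) inherits regular metricity from nabla^alpha.

   The analytic point is that K^-1 is smooth. Gram-Schmidt solves b_x(r(x),w) = phi_x(w) smoothly
   when b is positive definite; the nondegenerate case reduces to it through
   b_x(v,w) = sum_e h_x(v,e) h_x(w,e) over an orthonormal basis of the model space. *)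

theory Submission
  imports Defs
begin

section \<open>Calculus of smooth maps\<close>

text \<open>A connection acts on smooth fields over all of M, and both duality and parallelism are
  identities between such global fields. Descending from them to arbitrary tangent vectors at a
  point would normally require extending vectors by cut-off functions. This is avoided: K and K^-1
  map global smooth fields to global smooth fields, so the field that has to vanish can be paired
  with itself under the definite form g. This is why smoothness of K and K^-1 carries the analytic
  weight.

  Both maps solve one and the same problem, raising an index with a nondegenerate form. That form
  may be indefinite, and Gram-Schmidt would then risk dividing by zero at null vectors; hence the
  passage to a sum of squares. Since \<open>Ck_on\<close> tests derivatives in fixed directions,
  closure under sums, products and reciprocals of scalar functions is the calculus that Gram-Schmidt
  consumes.\<close>

lemma Ck_on_cong:
  assumes "open S" "\<And>x. x \<in> S \<Longrightarrow> f x = g x" "Ck_on k S f"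
  shows "Ck_on k S g"
  using assms(2,3)
proof (induction k arbitrary: f g)
  case 0
  then show ?case by (simp cong: continuous_on_cong)
next
  case (Suc k)
  have f: "f differentiable (at x)" if "x \<in> S" for x
    using Suc.prems(2) that by simp
  have f': "Ck_on k S (\<lambda>x. frechet_derivative f (at x) v)" for v
    using Suc.prems(2) by simp
  have der: "(g has_derivative frechet_derivative f (at x)) (at x)" if "x \<in> S" for x
    using f[OF that, unfolded frechet_derivative_works] \<open>open S\<close> that Suc.prems(1)
    by (intro has_derivative_transform_within_open[of f _ x UNIV S g])
  have "frechet_derivative f (at x) v = frechet_derivative g (at x) v" if "x \<in> S" for x v
    using frechet_derivative_at[OF der[OF that]] by simp
  then have "Ck_on k S (\<lambda>x. frechet_derivative g (at x) v)" for v
    using f' by (rule Suc.IH)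
  then show ?case using der by (auto simp: differentiable_def)
qed

text \<open>Uniqueness of the derivative identifies an explicit formula \<open>f'\<close> with
  \<open>frechet_derivative\<close>, so that the inductions on the order can use the usual
  differentiation rules.\<close>

lemma Ck_on_SucI:
  assumes "open S" "\<And>x. x \<in> S \<Longrightarrow> (f has_derivative f' x) (at x)"
    and "\<And>v. Ck_on k S (\<lambda>x. f' x v)"
  shows "Ck_on (Suc k) S f"
proof -
  have "frechet_derivative f (at x) = f' x" if "x \<in> S" for x
    using assms(2)[OF that] frechet_derivative_at by metis
  then have "Ck_on k S (\<lambda>x. frechet_derivative f (at x) v)" for v
    using Ck_on_cong[OF \<open>open S\<close> _ assms(3)[of v]] by simp
  then show ?thesis using assms(2) by (auto simp: differentiable_def)
qed

lemma Ck_on_SucD: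
  assumes "Ck_on (Suc k) S f"
  shows "\<And>x. x \<in> S \<Longrightarrow> (f has_derivative frechet_derivative f (at x)) (at x)"
    and "\<And>v. Ck_on k S (\<lambda>x. frechet_derivative f (at x) v)"
  using assms by (auto simp: frechet_derivative_works)

text \<open>For products and reciprocals: after differentiation the factors also occur
  undifferentiated, and there they are needed with the lower order.\<close>

lemma Ck_on_Suc_imp: "Ck_on (Suc k) S f \<Longrightarrow> Ck_on k S f"
proof (induction k arbitrary: f)
  case 0
  then show ?case
    by (auto intro!: continuous_at_imp_continuous_on differentiable_imp_continuous_within)
next
  case (Suc k)
  have "Ck_on k S (\<lambda>x. frechet_derivative f (at x) v)" for v
    using Ck_on_SucD(2)[OF Suc.prems, of v] by (rule Suc.IH)
  then show ?case using Suc.prems by simp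
qed

lemma Ck_on_const: "open S \<Longrightarrow> Ck_on k S (\<lambda>x. a)"
proof (induction k arbitrary: a)
  case (Suc k)
  then show ?case by (intro Ck_on_SucI[where f' = "\<lambda>x v. 0"]) auto
qed simp

lemma Ck_on_add:
  "open S \<Longrightarrow> Ck_on k S f \<Longrightarrow> Ck_on k S g \<Longrightarrow> Ck_on k S (\<lambda>x. f x + g x)"
proof (induction k arbitrary: f g)
  case 0
  then show ?case by (simp add: continuous_on_add)
next
  case (Suc k)
  note f = Ck_on_SucD[OF Suc.prems(2)] and g = Ck_on_SucD[OF Suc.prems(3)]
  show ?case
    by (rule Ck_on_SucI[OF \<open>open S\<close> has_derivative_add[OF f(1) g(1)]])
      (auto intro!: Suc.IH \<open>open S\<close> f g)
qed

lemma Ck_on_scaleR: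
  fixes f :: "'a::real_normed_vector \<Rightarrow> real"
  shows "open S \<Longrightarrow> Ck_on k S f \<Longrightarrow> Ck_on k S g \<Longrightarrow> Ck_on k S (\<lambda>x. f x *\<^sub>R g x)"
proof (induction k arbitrary: f g)
  case 0
  then show ?case by (simp add: continuous_on_scaleR)
next
  case (Suc k)
  note f = Ck_on_SucD[OF Suc.prems(2)] and g = Ck_on_SucD[OF Suc.prems(3)]
  show ?case
    by (rule Ck_on_SucI[OF \<open>open S\<close> has_derivative_scaleR[OF f(1) g(1)]], assumption, assumption)
      (intro Suc.IH Ck_on_add \<open>open S\<close> f(2) g(2) Suc.prems(2,3)[THEN Ck_on_Suc_imp])
qed

lemma Ck_on_inverse:
  fixes f :: "'a::real_normed_vector \<Rightarrow> real"
  assumes "open S" "\<And>x. x \<in> S \<Longrightarrow> f x \<noteq> 0"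
  shows "Ck_on k S f \<Longrightarrow> Ck_on k S (\<lambda>x. inverse (f x))"
proof (induction k)
  case 0
  then show ?case using assms by (simp add: continuous_on_inverse)
next
  case (Suc k)
  note f = Ck_on_SucD[OF Suc.prems]
  have inv: "Ck_on k S (\<lambda>x. inverse (f x))"
    by (rule Suc.IH[OF Ck_on_Suc_imp[OF Suc.prems]])
  \<comment> \<open>The derivative of 1/f contains 1/f again, but only to order k, where the
    induction hypothesis applies. The sign is written as a scalar factor so that closure under
    \<open>scaleR\<close> covers it.\<close>
  have "Ck_on k S (\<lambda>x. (- 1) *\<^sub>R (inverse (f x) *\<^sub>R (frechet_derivative f (at x) v *\<^sub>R inverse (f x))))" for v
    by (intro Ck_on_scaleR Ck_on_const \<open>open S\<close> inv f)
  then have "Ck_on k S (\<lambda>x. - (inverse (f x) * frechet_derivative f (at x) v * inverse (f x)))" for v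
    by (simp add: mult.assoc)
  then show ?case
    using Ck_on_SucI[OF \<open>open S\<close> Deriv.has_derivative_inverse[OF assms(2) f(1)], of k] by simp
qed

lemma Ck_on_bounded_linear:
  assumes "bounded_linear L" "open S"
  shows "Ck_on k S f \<Longrightarrow> Ck_on k S (\<lambda>x. L (f x))"
proof (induction k arbitrary: f)
  case 0
  then show ?case using bounded_linear.continuous_on[OF assms(1)] by simp
next
  case (Suc k)
  note f = Ck_on_SucD[OF Suc.prems]
  show ?case
    by (rule Ck_on_SucI[OF \<open>open S\<close> bounded_linear.has_derivative[OF assms(1) f(1)]])
      (assumption, rule Suc.IH[OF f(2)])
qed

section \<open>Closure properties of smooth maps\<close>

lemma smooth_on_cong:
  "smooth_on S f \<Longrightarrow> open S \<Longrightarrow> (\<And>x. x \<in> S \<Longrightarrow> f x = g x) \<Longrightarrow> smooth_on S g"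
  by (auto simp: smooth_on_def intro: Ck_on_cong[of S f g])

lemma smooth_on_const: "open S \<Longrightarrow> smooth_on S (\<lambda>x. a)"
  by (simp add: smooth_on_def Ck_on_const)

lemma smooth_on_add:
  "open S \<Longrightarrow> smooth_on S f \<Longrightarrow> smooth_on S g \<Longrightarrow> smooth_on S (\<lambda>x. f x + g x)"
  by (simp add: smooth_on_def Ck_on_add)

lemma smooth_on_scaleR:
  fixes f :: "'a::real_normed_vector \<Rightarrow> real"
  shows "open S \<Longrightarrow> smooth_on S f \<Longrightarrow> smooth_on S g \<Longrightarrow> smooth_on S (\<lambda>x. f x *\<^sub>R g x)"
  by (simp add: smooth_on_def Ck_on_scaleR)

lemma smooth_on_mult:
  fixes f g :: "'a::real_normed_vector \<Rightarrow> real"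
  shows "open S \<Longrightarrow> smooth_on S f \<Longrightarrow> smooth_on S g \<Longrightarrow> smooth_on S (\<lambda>x. f x * g x)"
  using smooth_on_scaleR[of S f g] by simp

lemma smooth_on_diff:
  assumes "open S" "smooth_on S f" "smooth_on S g"
  shows "smooth_on S (\<lambda>x. f x - g x)"
  using smooth_on_add[OF assms(1,2) smooth_on_scaleR[OF assms(1) smooth_on_const[of S "- 1"] assms(3)]]
    assms(1) by simp

lemma smooth_on_inverse:
  fixes f :: "'a::real_normed_vector \<Rightarrow> real"
  shows "open S \<Longrightarrow> (\<And>x. x \<in> S \<Longrightarrow> f x \<noteq> 0) \<Longrightarrow> smooth_on S f \<Longrightarrow> smooth_on S (\<lambda>x. inverse (f x))"
  by (simp add: smooth_on_def Ck_on_inverse)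

lemma smooth_on_inner_left:
  assumes "open S" "smooth_on S f"
  shows "smooth_on S (\<lambda>x. f x \<bullet> e)"
  unfolding smooth_on_def
  by (intro allI Ck_on_bounded_linear[OF bounded_linear_inner_left assms(1)]
      assms(2)[unfolded smooth_on_def, rule_format])

lemma smooth_on_sum:
  assumes "open S" "\<And>i. i \<in> I \<Longrightarrow> smooth_on S (f i)"
  shows "smooth_on S (\<lambda>x. \<Sum>i\<in>I. f i x)"
  using assms(2)
  by (induction I rule: infinite_finite_induct)
    (auto intro!: smooth_on_add smooth_on_const \<open>open S\<close>)

lemma smooth_on_imp_differentiable:
  "smooth_on S f \<Longrightarrow> x \<in> S \<Longrightarrow> f differentiable (at x)"
  unfolding smooth_on_def by (metis Ck_on.simps(2))

section \<open>Solving linear equations with smooth coefficients\<close>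

text \<open>A finite spanning set is orthogonalised and normalised. In dimension 0 the resulting B
  is empty.\<close>

lemma finite_dim_orthonormal_basis:
  assumes "finite_dim TYPE('e::real_inner)"
  obtains B :: "'e::real_inner set" where "finite B" "\<And>u. u = (\<Sum>e\<in>B. (u \<bullet> e) *\<^sub>R e)"
    "\<And>e e'. e \<in> B \<Longrightarrow> e' \<in> B \<Longrightarrow> e \<bullet> e' = (if e = e' then 1 else 0)"
proof -
  obtain B0 :: "'e set" where "finite B0" "span B0 = UNIV"
    using assms by (auto simp: finite_dim_def)
  then obtain C :: "'e set" where C: "finite C" "span C = UNIV" "pairwise orthogonal C"
    using basis_orthogonal[of B0] by auto
  \<comment> \<open>The orthogonal set C may contain 0, which cannot be normalised and contributes
    nothing to the span.\<close>
  define B where "B = sgn ` (C - {0})"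
  have fin: "finite B" using C by (simp add: B_def)
  have ortho: "e \<bullet> e' = (if e = e' then 1 else 0)" if ee': "e \<in> B" "e' \<in> B" for e e'
  proof -
    obtain c c' where c: "c \<in> C" "c \<noteq> 0" "e = sgn c" "c' \<in> C" "c' \<noteq> 0" "e' = sgn c'"
      using ee' by (auto simp: B_def)
    show ?thesis
    proof (cases "c = c'")
      case True
      then show ?thesis using c by (simp add: norm_sgn flip: norm_eq_1)
    next
      case False
      then have "c \<bullet> c' = 0" using C(3) c by (auto simp: pairwise_def orthogonal_def)
      then have "e \<bullet> e' = 0" using c by (simp add: sgn_div_norm)
      \<comment> \<open>With e orthogonal to e', this forces e \<noteq> e', so distinct vectors of C
        stay distinct after normalisation.\<close>
      moreover have "e \<bullet> e = 1" using c by (simp add: norm_sgn flip: norm_eq_1)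
      ultimately show ?thesis by auto
    qed
  qed
  have "C \<subseteq> span B"
  proof
    fix c assume "c \<in> C"
    show "c \<in> span B"
    proof (cases "c = 0")
      case False
      then have "c = norm c *\<^sub>R sgn c" by (simp add: sgn_div_norm)
      then show ?thesis using \<open>c \<in> C\<close> False
        by (metis B_def DiffI imageI singletonD span_base span_scale)
    qed (simp add: span_zero)
  qed
  then have spanB: "span B = UNIV"
    using C(2) span_minimal[OF _ subspace_span] by blast
  have "u = (\<Sum>e\<in>B. (u \<bullet> e) *\<^sub>R e)" for u
  proof -
    have "u \<in> span B" using spanB by simp
    then obtain a where a: "u = (\<Sum>e\<in>B. a e *\<^sub>R e)"
      using fin by (auto simp: span_finite)
    have "u \<bullet> e = a e" if "e \<in> B" for e
      using that fin by (simp add: a inner_sum_left ortho if_distrib cong: if_cong sum.cong)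
    then have "(\<Sum>e\<in>B. (u \<bullet> e) *\<^sub>R e) = (\<Sum>e\<in>B. a e *\<^sub>R e)" by simp
    with a show ?thesis by (rule trans[OF _ sym])
  qed
  with fin ortho show ?thesis using that by blast
qed

text \<open>Smoothness of \<phi> is known only at fixed arguments. Expanding r x in a fixed
  orthonormal basis leaves a finite sum of products of smooth functions.\<close>

lemma smooth_on_functional_apply:
  fixes \<phi> :: "'e::real_inner \<Rightarrow> 'e \<Rightarrow> real"
  assumes dim: "finite_dim TYPE('e)" and S: "open S"
    and lin: "\<And>x. x \<in> S \<Longrightarrow> linear (\<phi> x)"
    and smooth: "\<And>w. smooth_on S (\<lambda>x. \<phi> x w)" and r: "smooth_on S r"
  shows "smooth_on S (\<lambda>x. \<phi> x (r x))"
proof -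
  obtain B :: "'e set" where B: "\<And>u. u = (\<Sum>e\<in>B. (u \<bullet> e) *\<^sub>R e)"
    using finite_dim_orthonormal_basis[OF dim] by metis
  have "smooth_on S (\<lambda>x. \<Sum>e\<in>B. (r x \<bullet> e) * \<phi> x e)"
    by (intro smooth_on_sum smooth_on_mult smooth_on_inner_left S r smooth)
  moreover have "(\<Sum>e\<in>B. (r x \<bullet> e) * \<phi> x e) = \<phi> x (r x)" if "x \<in> S" for x
  proof -
    have "\<phi> x (r x) = \<phi> x (\<Sum>e\<in>B. (r x \<bullet> e) *\<^sub>R e)" by (rule arg_cong[OF B])
    then show ?thesis
      by (simp add: linear_sum[OF lin[OF that]] linear_cmul[OF lin[OF that]])
  qed
  ultimately show ?thesis by (rule smooth_on_cong[OF _ S])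
qed

text \<open>Riesz representation with a parameter, by Gram-Schmidt. The functional \<phi> stays
  arbitrary in the induction because the step solves for two functionals, and keeping r x in
  \<open>span T\<close> is what makes the new direction nonzero.\<close>

lemma smooth_riesz_on_span:
  fixes b :: "'e::real_inner \<Rightarrow> 'e \<Rightarrow> 'e \<Rightarrow> real"
  assumes dim: "finite_dim TYPE('e)" and S: "open S"
    and lin: "\<And>x w. x \<in> S \<Longrightarrow> linear (\<lambda>v. b x v w)"
    and sym: "\<And>x v w. x \<in> S \<Longrightarrow> b x v w = b x w v"
    and pos: "\<And>x v. x \<in> S \<Longrightarrow> v \<noteq> 0 \<Longrightarrow> b x v v > 0"
    and smooth: "\<And>v w. smooth_on S (\<lambda>x. b x v w)"
    and "finite T"
    and "\<And>x. x \<in> S \<Longrightarrow> linear (\<phi> x)" "\<And>w. smooth_on S (\<lambda>x. \<phi> x w)"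
  shows "\<exists>r. smooth_on S r \<and> (\<forall>x\<in>S. r x \<in> span T \<and> (\<forall>w\<in>span T. b x (r x) w = \<phi> x w))"
  using \<open>finite T\<close> assms(8,9)
proof (induction T arbitrary: \<phi> rule: finite_induct)
  case empty
  show ?case
    using empty linear_0[OF lin] linear_0[OF empty(1)]
    by (intro exI[of _ "\<lambda>x. 0"]) (auto simp: S smooth_on_const)
next
  case (insert t T)
  obtain r where r: "smooth_on S r" "\<And>x. x \<in> S \<Longrightarrow> r x \<in> span T"
      "\<And>x w. x \<in> S \<Longrightarrow> w \<in> span T \<Longrightarrow> b x (r x) w = \<phi> x w"
    using insert.IH[OF insert.prems] by auto
  show ?case
  proof (cases "t \<in> span T")
    case True
    then show ?thesis using r by (auto simp: span_redundant)
  next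
    case False
    have lin2: "linear (b x v)" if "x \<in> S" for x v
      using lin[OF that, of v] by (simp only: sym[OF that, of _ v])
    \<comment> \<open>s x is the projection of t onto \<open>span T\<close> that is orthogonal for b
      x: the induction hypothesis is used for the functional b x t.\<close>
    obtain s where s: "smooth_on S s" "\<And>x. x \<in> S \<Longrightarrow> s x \<in> span T"
        "\<And>x w. x \<in> S \<Longrightarrow> w \<in> span T \<Longrightarrow> b x (s x) w = b x t w"
      using insert.IH[of "\<lambda>x. b x t"] lin2 smooth by auto
    define n where "n x = t - s x" for x
    have n: "smooth_on S n" unfolding n_def by (intro smooth_on_diff smooth_on_const S s)
    have n_orth: "b x (n x) w = 0" if "x \<in> S" "w \<in> span T" for x w
      using s(3)[OF that] by (simp add: n_def linear_diff[OF lin[OF that(1)]])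
    \<comment> \<open>Since n x is orthogonal to s x, this number is b x (n x) (n x). It is the
      divisor in the definition of q.\<close>
    have nt: "b x (n x) t > 0" if x: "x \<in> S" for x
    proof -
      have "n x \<noteq> 0" using False s(2)[OF x] by (auto simp: n_def)
      then have "0 < b x (n x) (n x)" by (rule pos[OF x])
      also have "\<dots> = b x (n x) t - b x (n x) (s x)"
        by (subst (2) n_def) (simp add: linear_diff[OF lin2[OF x]])
      finally show ?thesis using n_orth[OF x s(2)[OF x]] by simp
    qed
    \<comment> \<open>A multiple of n x does not disturb the equations on \<open>span T\<close>; its
      coefficient is the one that makes the equation at t hold.\<close>
    define q where "q x = r x + ((\<phi> x t - b x (r x) t) * inverse (b x (n x) t)) *\<^sub>R n x" for x
    have app: "smooth_on S (\<lambda>x. b x (f x) t)" if "smooth_on S f" for f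
      using smooth_on_functional_apply[of S "\<lambda>x v. b x v t", OF dim S lin smooth that] .
    have "smooth_on S q"
      unfolding q_def
      by (intro smooth_on_add smooth_on_scaleR smooth_on_mult smooth_on_diff smooth_on_inverse S r
          n app insert.prems) (auto dest: nt)
    moreover have "q x \<in> span (insert t T)" if "x \<in> S" for x
    proof -
      have "r x \<in> span (insert t T)" "s x \<in> span (insert t T)" "t \<in> span (insert t T)"
        using r(2)[OF that] s(2)[OF that] span_mono[of T "insert t T"]
        by (auto intro: span_base)
      then show ?thesis unfolding q_def n_def by (intro span_add span_scale span_diff)
    qed
    moreover have "b x (q x) w = \<phi> x w" if x: "x \<in> S" and w: "w \<in> span (insert t T)" for x w
    proof -
      have bq: "b x (q x) w = b x (r x) w + (\<phi> x t - b x (r x) t) * inverse (b x (n x) t) * b x (n x) w" for w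
        by (simp add: q_def linear_add[OF lin[OF x]] linear_cmul[OF lin[OF x]])
      have "b x (q x) w = \<phi> x w" if "w \<in> insert t T" for w
      proof (cases "w = t")
        case True
        then show ?thesis using nt[OF x] by (simp add: bq mult.assoc)
      next
        case False
        then have "w \<in> span T" using that by (simp add: span_base)
        then show ?thesis using n_orth[OF x] r(3)[OF x] by (simp add: bq)
      qed
      then show ?thesis
        using linear_eq_on[OF lin2[OF x] insert.prems(1)[OF x] w] by blast
    qed
    ultimately show ?thesis by blast
  qed
qed

text \<open>In matrix terms h x is a symmetric invertible H, b is H^2 and \<psi> is H \<phi>. The
  definite case solves H^2 r = H \<phi> smoothly, and nondegeneracy then cancels one factor
  H.\<close>

lemma smooth_riesz:
  fixes h :: "'e::real_inner \<Rightarrow> 'e \<Rightarrow> 'e \<Rightarrow> real"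
  assumes dim: "finite_dim TYPE('e)" and S: "open S"
    and lin: "\<And>x w. x \<in> S \<Longrightarrow> linear (\<lambda>v. h x v w)"
    and sym: "\<And>x v w. x \<in> S \<Longrightarrow> h x v w = h x w v"
    and nondeg: "\<And>x v. x \<in> S \<Longrightarrow> (\<And>w. h x v w = 0) \<Longrightarrow> v = 0"
    and smooth: "\<And>v w. smooth_on S (\<lambda>x. h x v w)"
    and philin: "\<And>x. x \<in> S \<Longrightarrow> linear (\<phi> x)" and phismooth: "\<And>w. smooth_on S (\<lambda>x. \<phi> x w)"
  obtains r where "smooth_on S r" "\<And>x w. x \<in> S \<Longrightarrow> h x (r x) w = \<phi> x w"
proof -
  obtain B :: "'e set" where B: "finite B" "\<And>u. u = (\<Sum>e\<in>B. (u \<bullet> e) *\<^sub>R e)"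
    "\<And>e e'. e \<in> B \<Longrightarrow> e' \<in> B \<Longrightarrow> e \<bullet> e' = (if e = e' then 1 else 0)"
    using finite_dim_orthonormal_basis[OF dim] by metis
  have lin2: "linear (h x v)" if "x \<in> S" for x v
    using lin[OF that, of v] by (simp only: sym[OF that, of _ v])
  have expand: "f w = (\<Sum>e\<in>B. (w \<bullet> e) * f e)" if "linear f" for f :: "'e \<Rightarrow> real" and w
  proof -
    have "f w = f (\<Sum>e\<in>B. (w \<bullet> e) *\<^sub>R e)" by (rule arg_cong[OF B(2)])
    then show ?thesis by (simp add: linear_sum[OF that] linear_cmul[OF that])
  qed
  have spanB: "span B = UNIV"
  proof (rule UNIV_eq_I[symmetric])
    fix u
    have "(\<Sum>e\<in>B. (u \<bullet> e) *\<^sub>R e) \<in> span B" by (intro span_sum span_scale span_base)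
    then show "u \<in> span B" by (subst B(2))
  qed
  define b where "b x v w = (\<Sum>e\<in>B. h x v e * h x w e)" for x v w
  have pos: "b x v v > 0" if x: "x \<in> S" and "v \<noteq> 0" for x v
  proof -
    obtain w where w: "h x v w \<noteq> 0" using nondeg[OF x, of v] \<open>v \<noteq> 0\<close> by auto
    have "\<exists>e\<in>B. h x v e \<noteq> 0"
    proof (rule ccontr)
      assume "\<not> (\<exists>e\<in>B. h x v e \<noteq> 0)"
      then have "(\<Sum>e\<in>B. (w \<bullet> e) * h x v e) = 0" by (intro sum.neutral) simp
      then show False using w expand[OF lin2[OF x, of v], of w] by simp
    qed
    then obtain e where "e \<in> B" "h x v e \<noteq> 0" by blast
    then show ?thesis unfolding b_def using B(1)
      by (intro sum_pos2[of B e]) (auto simp: zero_less_mult_iff)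
  qed
  have blin: "linear (\<lambda>v. b x v w)" if "x \<in> S" for x w
    unfolding b_def
    by (rule linearI) (simp_all add: linear_add[OF lin[OF that]] linear_cmul[OF lin[OF that]]
        sum.distrib sum_distrib_left algebra_simps)
  define \<psi> where "\<psi> x w = (\<Sum>e\<in>B. \<phi> x e * h x w e)" for x w
  have "linear (\<psi> x)" if "x \<in> S" for x
    unfolding \<psi>_def
    by (rule linearI) (simp_all add: linear_add[OF lin[OF that]] linear_cmul[OF lin[OF that]]
        sum.distrib sum_distrib_left algebra_simps)
  moreover have "smooth_on S (\<lambda>x. \<psi> x w)" for w
    unfolding \<psi>_def by (intro smooth_on_sum smooth_on_mult S smooth phismooth)
  moreover have "smooth_on S (\<lambda>x. b x v w)" for v w
    unfolding b_def by (intro smooth_on_sum smooth_on_mult S smooth)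
  ultimately obtain r where r: "smooth_on S r" "\<And>x w. x \<in> S \<Longrightarrow> b x (r x) w = \<psi> x w"
    using smooth_riesz_on_span[of S b B \<psi>, OF dim S blin _ pos _ B(1)] spanB
    by (auto simp: b_def mult.commute)
  have "h x (r x) w = \<phi> x w" if x: "x \<in> S" for x w
  proof -
    \<comment> \<open>z holds the coordinates of the defect of r x as a solution. The equation for b
      says that the vector with these coordinates lies in the kernel of h x.\<close>
    define z where "z e = h x (r x) e - \<phi> x e" for e
    have "h x (\<Sum>e\<in>B. z e *\<^sub>R e) w = 0" for w
    proof -
      have "h x (\<Sum>e\<in>B. z e *\<^sub>R e) w = (\<Sum>e\<in>B. z e * h x e w)"
        by (simp add: linear_sum[OF lin[OF x]] linear_cmul[OF lin[OF x]])
      also have "\<dots> = b x (r x) w - \<psi> x w"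
        unfolding b_def \<psi>_def z_def
        by (simp add: algebra_simps sum_subtractf sym[OF x, of w])
      finally show ?thesis using r(2)[OF x] by simp
    qed
    then have z0: "(\<Sum>e\<in>B. z e *\<^sub>R e) = 0" by (rule nondeg[OF x])
    have "z e = 0" if "e \<in> B" for e
    proof -
      have "z e = (\<Sum>e\<in>B. z e *\<^sub>R e) \<bullet> e"
        using that by (simp add: inner_sum_left B(1,3) if_distrib cong: if_cong sum.cong)
      then show ?thesis using z0 by simp
    qed
    then show ?thesis
      using expand[OF lin2[OF x, of "r x"], of w] expand[OF philin[OF x], of w]
      by (simp add: z_def cong: sum.cong)
  qed
  with r(1) show ?thesis using that by blast
qed

section \<open>Tangent vectors in charts\<close>

lemma is_chart_simps:
  assumes "is_chart c"
  shows "open (chart_dom c)" "open (chart_image c)"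
    and "p \<in> chart_dom c \<Longrightarrow> chart_inv c (chart_map c p) = p"
    and "p \<in> chart_dom c \<Longrightarrow> chart_map c p \<in> chart_image c"
    and "x \<in> chart_image c \<Longrightarrow> chart_inv c x \<in> chart_dom c"
    and "x \<in> chart_image c \<Longrightarrow> chart_map c (chart_inv c x) = x"
  using assms by (auto simp: is_chart_def homeomorphism_def)

text \<open>Overlaps of charts, seen in coordinates, have this form; transferring a derivative
  between maps that agree there needs openness.\<close>

lemma open_chart_map_image:
  assumes "is_chart c" "open U"
  shows "open (chart_map c ` (chart_dom c \<inter> U))"
proof -
  have "chart_map c ` (chart_dom c \<inter> U) = chart_image c \<inter> chart_inv c -` U"
    using is_chart_simps(3-6)[OF assms(1)] by (force simp: image_iff)
  moreover have "continuous_on (chart_image c) (chart_inv c)"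
    using assms(1) by (simp add: is_chart_def homeomorphism_def)
  ultimately show ?thesis
    using is_chart_simps(2)[OF assms(1)] assms(2) by (simp add: continuous_open_preimage)
qed

lemma charts_at_is_chart:
  assumes "smooth_manifold A" "c \<in> charts_at A p"
  shows "c \<in> A" "is_chart c" "p \<in> chart_dom c"
  using assms by (auto simp: smooth_manifold_def charts_at_def)

lemma ex_chart_at:
  assumes "smooth_manifold A"
  shows "\<exists>c. c \<in> charts_at A p"
proof -
  have "p \<in> \<Union> (chart_dom ` A)" using assms by (simp add: smooth_manifold_def)
  then show ?thesis unfolding charts_at_def by blast
qed

lemma transition_has_derivative:
  assumes "smooth_manifold A" "c \<in> charts_at A p" "c' \<in> charts_at A p"
  shows "(transition c c' has_derivative frechet_derivative (transition c c') (at (chart_map c p)))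
    (at (chart_map c p))"
proof -
  have "smooth_on (chart_map c ` (chart_dom c \<inter> chart_dom c')) (transition c c')"
    "chart_map c p \<in> chart_map c ` (chart_dom c \<inter> chart_dom c')"
    using assms by (auto simp: smooth_manifold_def charts_at_def)
  then show ?thesis
    using smooth_on_imp_differentiable frechet_derivative_works by blast
qed

lemma linear_transition_derivative:
  assumes "smooth_manifold A" "c \<in> charts_at A p" "c' \<in> charts_at A p"
  shows "linear (frechet_derivative (transition c c') (at (chart_map c p)))"
  using transition_has_derivative[OF assms] by (rule has_derivative_linear)

text \<open>The chain rule in cocycle form. It is what makes \<open>coord_vec\<close> compatible
  with every pair of charts at p.\<close>

lemma transition_derivative_comp:
  assumes M: "smooth_manifold A"
    and c: "c \<in> charts_at A p" and c': "c' \<in> charts_at A p" and c'': "c'' \<in> charts_at A p"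
  shows "frechet_derivative (transition c c'') (at (chart_map c p)) v =
    frechet_derivative (transition c' c'') (at (chart_map c' p))
      (frechet_derivative (transition c c') (at (chart_map c p)) v)"
proof -
  note ch = charts_at_is_chart[OF M c] and ch' = charts_at_is_chart[OF M c']
  have at_p: "transition c c' (chart_map c p) = chart_map c' p"
    using is_chart_simps(3)[OF ch(2,3)] by (simp add: transition_def)
  have "(transition c' c'' \<circ> transition c c' has_derivative
      frechet_derivative (transition c' c'') (at (chart_map c' p)) \<circ>
      frechet_derivative (transition c c') (at (chart_map c p))) (at (chart_map c p))"
    using transition_has_derivative[OF M c c'] transition_has_derivative[OF M c' c'']
    by (intro diff_chain_at) (simp_all add: at_p)
  \<comment> \<open>The composite is known to equal the direct transition only over the domain of
    the middle chart c', so the derivative is transferred on that open set.\<close>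
  then have "(transition c c'' has_derivative
      frechet_derivative (transition c' c'') (at (chart_map c' p)) \<circ>
      frechet_derivative (transition c c') (at (chart_map c p))) (at (chart_map c p))"
  proof (rule has_derivative_transform_within_open)
    show "open (chart_map c ` (chart_dom c \<inter> chart_dom c'))"
      by (rule open_chart_map_image[OF ch(2) is_chart_simps(1)[OF ch'(2)]])
    show "chart_map c p \<in> chart_map c ` (chart_dom c \<inter> chart_dom c')"
      using ch ch' by auto
    show "(transition c' c'' \<circ> transition c c') x = transition c c'' x"
      if "x \<in> chart_map c ` (chart_dom c \<inter> chart_dom c')" for x
      using that is_chart_simps(3)[OF ch(2)] is_chart_simps(3)[OF ch'(2)]
      by (auto simp: transition_def)
  qed
  from fun_cong[OF frechet_derivative_at[OF this], of v] show ?thesis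
    unfolding comp_apply by (rule sym)
qed

lemma transition_derivative_self:
  assumes M: "smooth_manifold A" and c: "c \<in> charts_at A p"
  shows "frechet_derivative (transition c c) (at (chart_map c p)) v = v"
proof -
  note ch = charts_at_is_chart[OF M c]
  have "(transition c c has_derivative (\<lambda>v. v)) (at (chart_map c p))"
    by (rule has_derivative_transform_within_open[OF has_derivative_ident is_chart_simps(2)[OF ch(2)]
          is_chart_simps(4)[OF ch(2,3)]])
      (simp add: transition_def is_chart_simps(6)[OF ch(2)])
  from fun_cong[OF frechet_derivative_at[OF this], of v] show ?thesis by simp
qed

section \<open>The model space as a coordinate copy of the tangent space\<close>

lemma coord_vec_in_tangent_space:
  assumes "smooth_manifold A" "c \<in> charts_at A p"
  shows "coord_vec A c p v \<in> tangent_space A p"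
  unfolding tangent_space_def coord_vec_def
  by (simp, intro ballI transition_derivative_comp[OF assms])

lemma coord_vec_apply_self:
  assumes "smooth_manifold A" "c \<in> charts_at A p"
  shows "coord_vec A c p v c = v"
  using assms(2) by (simp add: coord_vec_def transition_derivative_self[OF assms])

text \<open>A tangent vector is determined by its entry in one chart. With
  \<open>coord_vec_apply_self\<close> this identifies the tangent space with the model space; the
  zero entries outside \<open>charts_at\<close> make it an equality of whole families.\<close>

lemma coord_vec_of_tangent:
  assumes "c \<in> charts_at A p" "u \<in> tangent_space A p"
  shows "coord_vec A c p (u c) = u"
proof
  fix c'
  show "coord_vec A c p (u c) c' = u c'"
  proof (cases "c' \<in> charts_at A p")
    case True
    then have "u c' = frechet_derivative (transition c c') (at (chart_map c p)) (u c)"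
      using assms unfolding tangent_space_def by blast
    then show ?thesis using True by (simp add: coord_vec_def)
  next
    case False
    then have "u c' = 0" using assms(2) unfolding tangent_space_def by blast
    then show ?thesis using False by (simp add: coord_vec_def)
  qed
qed

lemma coord_vec_linear_combination:
  assumes "smooth_manifold A" "c \<in> charts_at A p"
  shows "coord_vec A c p (a *\<^sub>R v + b *\<^sub>R w) =
    (\<lambda>c'. a *\<^sub>R coord_vec A c p v c' + b *\<^sub>R coord_vec A c p w c')"
  by (auto simp: coord_vec_def linear_add[OF linear_transition_derivative[OF assms]]
      linear_cmul[OF linear_transition_derivative[OF assms]])

text \<open>One chart suffices: the combination is the coordinate vector of the combined
  coordinates.\<close>

lemma tangent_space_linear_combination:
  assumes M: "smooth_manifold A" and u: "u \<in> tangent_space A p" and v: "v \<in> tangent_space A p"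
  shows "(\<lambda>c. a *\<^sub>R u c + b *\<^sub>R v c) \<in> tangent_space A p"
proof -
  obtain c where c: "c \<in> charts_at A p" using ex_chart_at[OF M] by blast
  have "coord_vec A c p (a *\<^sub>R u c + b *\<^sub>R v c) = (\<lambda>c. a *\<^sub>R u c + b *\<^sub>R v c)"
    by (simp only: coord_vec_linear_combination[OF M c] coord_vec_of_tangent[OF c u]
        coord_vec_of_tangent[OF c v])
  then show ?thesis
    using coord_vec_in_tangent_space[OF M c, of "a *\<^sub>R u c + b *\<^sub>R v c"] by (simp only:)
qed

lemma smooth_vfields_linear_combination:
  assumes M: "smooth_manifold A" and X: "X \<in> smooth_vfields A" and Y: "Y \<in> smooth_vfields A"
  shows "(\<lambda>p c. a *\<^sub>R X p c + b *\<^sub>R Y p c) \<in> smooth_vfields A"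
proof -
  have "smooth_on (chart_image c) (\<lambda>x. a *\<^sub>R vf_rep c X x + b *\<^sub>R vf_rep c Y x)" if "c \<in> A" for c
  proof -
    have "open (chart_image c)" using M that by (simp add: smooth_manifold_def is_chart_def)
    moreover have "smooth_on (chart_image c) (vf_rep c X)" "smooth_on (chart_image c) (vf_rep c Y)"
      using X Y that by (auto simp: smooth_vfields_def)
    ultimately show ?thesis by (intro smooth_on_add smooth_on_scaleR smooth_on_const)
  qed
  moreover have "(\<lambda>c. a *\<^sub>R X p c + b *\<^sub>R Y p c) \<in> tangent_space A p" for p
    using X Y by (intro tangent_space_linear_combination[OF M]) (simp_all add: smooth_vfields_def)
  ultimately show ?thesis
    by (simp add: smooth_vfields_def vf_rep_def)
qed

section \<open>Nondegenerate forms and musical isomorphisms\<close>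

lemma smooth_sym_form_sym:
  "smooth_sym_form A h \<Longrightarrow> u \<in> tangent_space A p \<Longrightarrow> v \<in> tangent_space A p \<Longrightarrow> h p u v = h p v u"
  by (simp add: smooth_sym_form_def)

lemma smooth_sym_form_left:
  "smooth_sym_form A h \<Longrightarrow> u \<in> tangent_space A p \<Longrightarrow> v \<in> tangent_space A p \<Longrightarrow>
    w \<in> tangent_space A p \<Longrightarrow> h p (\<lambda>c. a *\<^sub>R u c + b *\<^sub>R v c) w = a * h p u w + b * h p v w"
  by (simp add: smooth_sym_form_def)

lemma smooth_sym_form_right:
  assumes "smooth_manifold A" "smooth_sym_form A h" "u \<in> tangent_space A p"
    "v \<in> tangent_space A p" "w \<in> tangent_space A p"
  shows "h p w (\<lambda>c. a *\<^sub>R u c + b *\<^sub>R v c) = a * h p w u + b * h p w v"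
  using smooth_sym_form_left[OF assms(2-5), of a b] tangent_space_linear_combination[OF assms(1,3,4), of a b]
    smooth_sym_form_sym[OF assms(2)] assms(3-5) by metis

lemma nondegenerate_eqI:
  assumes M: "smooth_manifold A" and h: "smooth_sym_form A h" "nondegenerate A h"
    and u: "u \<in> tangent_space A p" and v: "v \<in> tangent_space A p"
    and eq: "\<And>w. w \<in> tangent_space A p \<Longrightarrow> h p u w = h p v w"
  shows "u = v"
proof -
  have "(\<lambda>c. 1 *\<^sub>R u c + (- 1) *\<^sub>R v c) = (\<lambda>_. 0)"
    using tangent_space_linear_combination[OF M u v, of 1 "- 1"]
      smooth_sym_form_left[OF h(1) u v, of _ 1 "- 1"] h(2) eq
    unfolding nondegenerate_def by auto
  then show ?thesis by (auto simp: fun_eq_iff)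
qed

lemma riemannian_metric_nondegenerate:
  assumes "riemannian_metric A g"
  shows "nondegenerate A g"
  using assms unfolding riemannian_metric_def nondegenerate_def by (metis less_irrefl)

section \<open>Forms and functionals read in a chart\<close>

lemma linear_form_in_chart:
  assumes M: "smooth_manifold A" and c: "c \<in> charts_at A p"
    and L: "\<And>u v a b. u \<in> tangent_space A p \<Longrightarrow> v \<in> tangent_space A p \<Longrightarrow>
      L (\<lambda>c. a *\<^sub>R u c + b *\<^sub>R v c) = a * L u + b * L v"
  shows "linear (\<lambda>v. L (coord_vec A c p v) :: real)"
proof (rule linearI)
  note comb = coord_vec_linear_combination[OF M c] L[OF coord_vec_in_tangent_space[OF M c]
      coord_vec_in_tangent_space[OF M c]]
  show "L (coord_vec A c p (v + w)) = L (coord_vec A c p v) + L (coord_vec A c p w)" for v w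
    using comb(1)[of 1 v 1 w] comb(2)[of 1 v 1 w] by simp
  show "L (coord_vec A c p (a *\<^sub>R v)) = a *\<^sub>R L (coord_vec A c p v)" for a v
    using comb(1)[of a v 0 v] comb(2)[of a v 0 v] by simp
qed

lemma chart_inv_charts_at:
  assumes "smooth_manifold A" "c \<in> A" "x \<in> chart_image c"
  shows "c \<in> charts_at A (chart_inv c x)"
  using assms is_chart_simps(5)[of c x] by (auto simp: charts_at_def smooth_manifold_def)

lemma smooth_form_apply_in_chart:
  assumes M: "smooth_manifold A" and h: "smooth_sym_form A h" and c: "c \<in> A"
    and y: "smooth_on (chart_image c) y"
  shows "smooth_on (chart_image c)
    (\<lambda>x. h (chart_inv c x) (coord_vec A c (chart_inv c x) (y x)) (coord_vec A c (chart_inv c x) w))"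
proof (rule smooth_on_functional_apply[of _ "\<lambda>x v. h (chart_inv c x)
      (coord_vec A c (chart_inv c x) v) (coord_vec A c (chart_inv c x) w)"])
  show "finite_dim TYPE('b)" "open (chart_image c)"
    using M c by (auto simp: smooth_manifold_def is_chart_def)
  show "linear (\<lambda>v. h (chart_inv c x) (coord_vec A c (chart_inv c x) v) (coord_vec A c (chart_inv c x) w))"
    if "x \<in> chart_image c" for x
    using chart_inv_charts_at[OF M c that]
    by (intro linear_form_in_chart[OF M] smooth_sym_form_left[OF h] coord_vec_in_tangent_space[OF M])
  show "smooth_on (chart_image c) (\<lambda>x. h (chart_inv c x)
      (coord_vec A c (chart_inv c x) v) (coord_vec A c (chart_inv c x) w))" for v
    using h c by (simp add: smooth_sym_form_def)
qed (rule y)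

text \<open>L is constrained only over the domain of c, so that it may be built from a coordinate
  field of c, which is a field only there.\<close>

lemma chart_riesz:
  fixes A :: "('m::{t2_space, second_countable_topology}, 'e::real_inner) chart set"
  assumes M: "smooth_manifold A" and h: "smooth_sym_form A h" "nondegenerate A h" and c: "c \<in> A"
    and L: "\<And>p u v a b. p \<in> chart_dom c \<Longrightarrow> u \<in> tangent_space A p \<Longrightarrow> v \<in> tangent_space A p \<Longrightarrow>
      L p (\<lambda>c. a *\<^sub>R u c + b *\<^sub>R v c) = a * L p u + b * L p v"
    and Lsmooth: "\<And>w. smooth_on (chart_image c)
      (\<lambda>x. L (chart_inv c x) (coord_vec A c (chart_inv c x) w))"
  shows "\<exists>r. smooth_on (chart_image c) r \<and> (\<forall>p\<in>chart_dom c. \<forall>w\<in>tangent_space A p.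
      h p (coord_vec A c p (r (chart_map c p))) w = L p w)"
proof -
  define H where "H x v w = h (chart_inv c x) (coord_vec A c (chart_inv c x) v)
    (coord_vec A c (chart_inv c x) w)" for x v w
  have chart: "is_chart c" and dim: "finite_dim TYPE('e)"
    using M c by (auto simp: smooth_manifold_def)
  note cx = chart_inv_charts_at[OF M c]
  have "\<exists>r. smooth_on (chart_image c) r \<and> (\<forall>x\<in>chart_image c. \<forall>w.
      H x (r x) w = L (chart_inv c x) (coord_vec A c (chart_inv c x) w))"
  proof (rule smooth_riesz[of "chart_image c" H "\<lambda>x w. L (chart_inv c x) (coord_vec A c (chart_inv c x) w)",
        OF dim is_chart_simps(2)[OF chart] _ _ _ _ _ Lsmooth])
    fix x v w assume x: "x \<in> chart_image c"
    note cv = coord_vec_in_tangent_space[OF M cx[OF x]]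
    show "linear (\<lambda>v. H x v w)"
      unfolding H_def by (intro linear_form_in_chart[OF M cx[OF x]] smooth_sym_form_left[OF h(1)] cv)
    show "H x v w = H x w v"
      unfolding H_def by (intro smooth_sym_form_sym[OF h(1)] cv)
    show "linear (\<lambda>w. L (chart_inv c x) (coord_vec A c (chart_inv c x) w))"
      using x by (intro linear_form_in_chart[OF M cx[OF x]] L is_chart_simps(5)[OF chart])
  next
    fix x v assume x: "x \<in> chart_image c" and 0: "\<And>w. H x v w = 0"
    note cv = coord_vec_in_tangent_space[OF M cx[OF x]]
    \<comment> \<open>Coordinate vectors are enough as test vectors, because w is the coordinate
      vector of its entry w c.\<close>
    have "h (chart_inv c x) (coord_vec A c (chart_inv c x) v) w = 0"
      if "w \<in> tangent_space A (chart_inv c x)" for w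
      using 0[of "w c"] coord_vec_of_tangent[OF cx[OF x] that] by (simp add: H_def)
    then have "coord_vec A c (chart_inv c x) v = (\<lambda>_. 0)"
      using h(2) cv unfolding nondegenerate_def by blast
    then show "v = 0"
      using coord_vec_apply_self[OF M cx[OF x], of v] by simp
  next
    show "smooth_on (chart_image c) (\<lambda>x. H x v w)" for v w
      using h(1) c by (simp add: H_def smooth_sym_form_def)
  qed blast
  then obtain r where r: "smooth_on (chart_image c) r"
    "\<And>x w. x \<in> chart_image c \<Longrightarrow> H x (r x) w = L (chart_inv c x) (coord_vec A c (chart_inv c x) w)"
    by blast
  have "h p (coord_vec A c p (r (chart_map c p))) w = L p w"
    if p: "p \<in> chart_dom c" and w: "w \<in> tangent_space A p" for p w
  proof -
    have "c \<in> charts_at A p" using c p by (simp add: charts_at_def)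
    then show ?thesis
      using r(2)[OF is_chart_simps(4)[OF chart p], of "w c"] coord_vec_of_tangent[of c A p w] w
      by (simp add: H_def is_chart_simps(3)[OF chart p])
  qed
  with r(1) show ?thesis by blast
qed

text \<open>Raising an index with h. For h(u,v) = g(K u,v) and L = g p u the result is K^-1 u. The
  choice is pointwise; nondegeneracy makes it unique, and smoothness is recovered from
  uniqueness.\<close>

definition sharp ::
    "('m, 'e::real_normed_vector) chart set \<Rightarrow> ('m, 'e) tform \<Rightarrow> 'm \<Rightarrow> (('m, 'e) tvec \<Rightarrow> real) \<Rightarrow> ('m, 'e) tvec"
  where "sharp A h p L =
    (SOME u. u \<in> tangent_space A p \<and> (\<forall>w\<in>tangent_space A p. h p u w = L w))"

lemma sharp:
  assumes M: "smooth_manifold A" and h: "smooth_sym_form A h" "nondegenerate A h"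
    and L: "\<And>u v a b. u \<in> tangent_space A p \<Longrightarrow> v \<in> tangent_space A p \<Longrightarrow>
      L (\<lambda>c. a *\<^sub>R u c + b *\<^sub>R v c) = a * L u + b * L v"
  shows "sharp A h p L \<in> tangent_space A p"
    and "w \<in> tangent_space A p \<Longrightarrow> h p (sharp A h p L) w = L w"
proof -
  obtain c where c: "c \<in> charts_at A p" using ex_chart_at[OF M] by blast
  note ch = charts_at_is_chart[OF M c]
  (* Extend L to the chart domain with constant components. *)
  define L' where "L' q w = L (coord_vec A c p (w c))" for q :: 'a and w
  have "\<exists>r. smooth_on (chart_image c) r \<and> (\<forall>q\<in>chart_dom c. \<forall>w\<in>tangent_space A q.
      h q (coord_vec A c q (r (chart_map c q))) w = L' q w)"
  proof (rule chart_riesz[OF M h ch(1)])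
    show "L' q (\<lambda>c. a *\<^sub>R u c + b *\<^sub>R v c) = a * L' q u + b * L' q v" for q a b u v
      unfolding L'_def coord_vec_linear_combination[OF M c]
      by (intro L coord_vec_in_tangent_space[OF M c])
    have "smooth_on (chart_image c) (\<lambda>x. L (coord_vec A c p w))" for w
      by (rule smooth_on_const[OF is_chart_simps(2)[OF ch(2)]])
    then show "smooth_on (chart_image c) (\<lambda>x. L' (chart_inv c x) (coord_vec A c (chart_inv c x) w))" for w
      by (rule smooth_on_cong)
        (simp_all add: L'_def is_chart_simps(2)[OF ch(2)]
          coord_vec_apply_self[OF M chart_inv_charts_at[OF M ch(1)]])
  qed
  then obtain r where r: "\<And>q w. q \<in> chart_dom c \<Longrightarrow> w \<in> tangent_space A q \<Longrightarrow>
      h q (coord_vec A c q (r (chart_map c q))) w = L' q w"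
    by blast
  have "h p (coord_vec A c p (r (chart_map c p))) w = L w" if "w \<in> tangent_space A p" for w
    using r[OF ch(3) that] coord_vec_of_tangent[OF c that] by (simp add: L'_def)
  then have "\<exists>u. u \<in> tangent_space A p \<and> (\<forall>w\<in>tangent_space A p. h p u w = L w)"
    using coord_vec_in_tangent_space[OF M c] by blast
  from someI_ex[OF this] show "sharp A h p L \<in> tangent_space A p"
    "w \<in> tangent_space A p \<Longrightarrow> h p (sharp A h p L) w = L w"
    by (auto simp: sharp_def)
qed

lemma sharp_form:
  assumes M: "smooth_manifold A" and h: "smooth_sym_form A h" "nondegenerate A h"
    and g: "smooth_sym_form A g" and u: "u \<in> tangent_space A p"
  shows "sharp A h p (g p u) \<in> tangent_space A p"
    and "w \<in> tangent_space A p \<Longrightarrow> h p (sharp A h p (g p u)) w = g p u w"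
proof -
  note sh = sharp[OF M h, where p = p and L = "g p u", OF smooth_sym_form_right[OF M g _ _ u]]
  show "sharp A h p (g p u) \<in> tangent_space A p" by (rule sh(1))
  show "w \<in> tangent_space A p \<Longrightarrow> h p (sharp A h p (g p u)) w = g p u w" by (rule sh(2))
qed

text \<open>A smooth solution exists over the chart, and nondegeneracy forces the pointwise choice
  to coincide with it.\<close>

lemma sharp_in_chart:
  assumes M: "smooth_manifold A" and h: "smooth_sym_form A h" "nondegenerate A h" and c: "c \<in> A"
    and L: "\<And>p u v a b. p \<in> chart_dom c \<Longrightarrow> u \<in> tangent_space A p \<Longrightarrow> v \<in> tangent_space A p \<Longrightarrow>
      L p (\<lambda>c. a *\<^sub>R u c + b *\<^sub>R v c) = a * L p u + b * L p v"
    and Lsmooth: "\<And>w. smooth_on (chart_image c)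
      (\<lambda>x. L (chart_inv c x) (coord_vec A c (chart_inv c x) w))"
  shows "smooth_on (chart_image c) (\<lambda>x. sharp A h (chart_inv c x) (L (chart_inv c x)) c)"
proof -
  have chart: "is_chart c" using M c by (simp add: smooth_manifold_def)
  have "\<exists>r. smooth_on (chart_image c) r \<and> (\<forall>p\<in>chart_dom c. \<forall>w\<in>tangent_space A p.
      h p (coord_vec A c p (r (chart_map c p))) w = L p w)"
    by (rule chart_riesz[OF M h c]) (fact L, fact Lsmooth)
  then obtain r where r: "smooth_on (chart_image c) r"
    "\<And>p w. p \<in> chart_dom c \<Longrightarrow> w \<in> tangent_space A p \<Longrightarrow>
      h p (coord_vec A c p (r (chart_map c p))) w = L p w"
    by blast
  have "r x = sharp A h (chart_inv c x) (L (chart_inv c x)) c" if x: "x \<in> chart_image c" for x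
  proof -
    note cx = chart_inv_charts_at[OF M c x] and dom = is_chart_simps(5)[OF chart x]
    have sh: "sharp A h (chart_inv c x) (L (chart_inv c x)) \<in> tangent_space A (chart_inv c x)"
      by (rule sharp(1)[OF M h]) (rule L[OF dom])
    have sh': "h (chart_inv c x) (sharp A h (chart_inv c x) (L (chart_inv c x))) w = L (chart_inv c x) w"
      if "w \<in> tangent_space A (chart_inv c x)" for w
      by (rule sharp(2)[OF M h _ that]) (rule L[OF dom])
    have "coord_vec A c (chart_inv c x) (r x) = sharp A h (chart_inv c x) (L (chart_inv c x))"
      by (rule nondegenerate_eqI[OF M h coord_vec_in_tangent_space[OF M cx] sh])
        (simp add: sh' r(2)[OF dom, unfolded is_chart_simps(6)[OF chart x]])
    then show ?thesis using coord_vec_apply_self[OF M cx, of "r x"] by simp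
  qed
  then show ?thesis by (rule smooth_on_cong[OF r(1) is_chart_simps(2)[OF chart]])
qed

text \<open>This is K^-1 acting on fields; with g and h exchanged it is K. Both uses occur in the
  duality argument.\<close>

lemma sharp_smooth_vfield:
  assumes M: "smooth_manifold A" and h: "smooth_sym_form A h" "nondegenerate A h"
    and g: "smooth_sym_form A g" and U: "U \<in> smooth_vfields A"
  shows "(\<lambda>p. sharp A h p (g p (U p))) \<in> smooth_vfields A"
proof -
  have Up: "U p \<in> tangent_space A p" for p using U by (simp add: smooth_vfields_def)
  note gU = smooth_sym_form_right[OF M g _ _ Up]
  have "smooth_on (chart_image c) (\<lambda>x. sharp A h (chart_inv c x) (g (chart_inv c x) (U (chart_inv c x))) c)"
    if c: "c \<in> A" for c
  proof (rule sharp_in_chart[OF M h c, of "\<lambda>p. g p (U p)"])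
    fix w
    have chart: "is_chart c" using M c by (simp add: smooth_manifold_def)
    have "smooth_on (chart_image c) (\<lambda>x. g (chart_inv c x)
        (coord_vec A c (chart_inv c x) (vf_rep c U x)) (coord_vec A c (chart_inv c x) w))"
      using U c by (intro smooth_form_apply_in_chart[OF M g c]) (simp add: smooth_vfields_def)
    then show "smooth_on (chart_image c) (\<lambda>x. g (chart_inv c x) (U (chart_inv c x))
        (coord_vec A c (chart_inv c x) w))"
      by (rule smooth_on_cong[OF _ is_chart_simps(2)[OF chart]])
        (simp add: vf_rep_def coord_vec_of_tangent[OF chart_inv_charts_at[OF M c] Up])
  qed (rule gU)
  then show ?thesis
    using sharp_form(1)[OF M h g Up] by (simp add: smooth_vfields_def vf_rep_def)
qed

section \<open>Duality\<close>

(* If h = g(K _, _), this is g(K^-1 _, _). *)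
definition dual_form ::
    "('m, 'e::real_normed_vector) chart set \<Rightarrow> ('m, 'e) tform \<Rightarrow> ('m, 'e) tform \<Rightarrow> ('m, 'e) tform"
  where "dual_form A g h p u v = g p (sharp A h p (g p u)) v"

text \<open>Write S u for \<open>sharp A h p (g p u)\<close>. The dual form is the pullback of h
  along S, hence symmetric. If it annihilates u, then S u = 0, so g p u = h p (S u) = 0 and u =
  0.\<close>

lemma
  assumes M: "smooth_manifold A" and h: "smooth_sym_form A h" "nondegenerate A h"
    and g: "smooth_sym_form A g" "nondegenerate A g"
  shows smooth_sym_form_dual_form: "smooth_sym_form A (dual_form A g h)"
    and nondegenerate_dual_form: "nondegenerate A (dual_form A g h)"
proof -
  have S: "sharp A h p (g p u) \<in> tangent_space A p"
    and Sh: "w \<in> tangent_space A p \<Longrightarrow> h p (sharp A h p (g p u)) w = g p u w"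
    if "u \<in> tangent_space A p" for p u w
    using sharp_form[OF M h g(1) that] by blast+
  have eq: "dual_form A g h p u v = h p (sharp A h p (g p v)) (sharp A h p (g p u))"
    if "u \<in> tangent_space A p" "v \<in> tangent_space A p" for p u v
    using Sh[OF that(2) S[OF that(1)]] smooth_sym_form_sym[OF g(1) S[OF that(1)] that(2)]
    by (simp add: dual_form_def)
  have sym: "dual_form A g h p u v = dual_form A g h p v u"
    if uv: "u \<in> tangent_space A p" "v \<in> tangent_space A p" for p u v
    using eq[OF uv] eq[OF uv(2,1)] smooth_sym_form_sym[OF h(1) S[OF uv(1)] S[OF uv(2)]] by simp
  \<comment> \<open>Symmetry moves the combination into the second slot, where linearity is that of
    g rather than that of \<open>sharp\<close>.\<close>
  have lin: "dual_form A g h p (\<lambda>c. a *\<^sub>R u c + b *\<^sub>R v c) w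
      = a * dual_form A g h p u w + b * dual_form A g h p v w"
    if uvw: "u \<in> tangent_space A p" "v \<in> tangent_space A p" "w \<in> tangent_space A p" for p u v w a b
  proof -
    note uv = tangent_space_linear_combination[OF M uvw(1,2), of a b]
    show ?thesis
      using sym[OF uv uvw(3)] sym[OF uvw(1,3)] sym[OF uvw(2,3)]
        smooth_sym_form_right[OF M g(1) uvw(1,2) S[OF uvw(3)], of a b]
      by (simp add: dual_form_def)
  qed
  have smooth: "smooth_on (chart_image c) (\<lambda>x. dual_form A g h (chart_inv c x)
      (coord_vec A c (chart_inv c x) v) (coord_vec A c (chart_inv c x) w))"
    if c: "c \<in> A" for c v w
  proof -
    have chart: "is_chart c" using M c by (simp add: smooth_manifold_def)
    note cx = chart_inv_charts_at[OF M c]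
    \<comment> \<open>y represents S applied to the coordinate field of v. That field lives only
      over the chart, so the local \<open>sharp_in_chart\<close> is used rather than the version for
      global fields.\<close>
    define y where "y x = sharp A h (chart_inv c x) (g (chart_inv c x) (coord_vec A c (chart_inv c x) v)) c" for x
    have "smooth_on (chart_image c) y"
      unfolding y_def
    proof (rule sharp_in_chart[OF M h c, of "\<lambda>p. g p (coord_vec A c p v)"])
      show "smooth_on (chart_image c) (\<lambda>x. g (chart_inv c x)
          (coord_vec A c (chart_inv c x) v) (coord_vec A c (chart_inv c x) w))" for w
        using g(1) c by (simp add: smooth_sym_form_def)
    qed (auto intro!: smooth_sym_form_right[OF M g(1)] coord_vec_in_tangent_space[OF M]
        simp: charts_at_def c)
    from smooth_form_apply_in_chart[OF M g(1) c this, of w] show ?thesis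
      by (rule smooth_on_cong[OF _ is_chart_simps(2)[OF chart]])
        (simp add: y_def dual_form_def coord_vec_of_tangent[OF cx S]
          coord_vec_in_tangent_space[OF M] cx)
  qed
  show "smooth_sym_form A (dual_form A g h)"
    unfolding smooth_sym_form_def by (intro conjI allI ballI sym lin smooth)
  show "nondegenerate A (dual_form A g h)"
    unfolding nondegenerate_def
  proof (intro allI ballI impI)
    fix p u assume u: "u \<in> tangent_space A p" and 0: "\<forall>v\<in>tangent_space A p. dual_form A g h p u v = 0"
    then have Su: "sharp A h p (g p u) = (\<lambda>_. 0)"
      using g(2) S[OF u] unfolding nondegenerate_def dual_form_def by blast
    \<comment> \<open>The instance with coefficients 0 and 0 says that h p vanishes when its first
      argument is the zero family.\<close>
    have "g p u w = 0" if w: "w \<in> tangent_space A p" for w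
      using Sh[OF u w] smooth_sym_form_left[OF h(1) u u w, of 0 0] by (simp add: Su)
    then show "u = (\<lambda>_. 0)" using g(2) u unfolding nondegenerate_def by blast
  qed
qed

text \<open>Differentiating g(U,W) = h(S U,W) by duality on one side and by parallelism of h on the
  other gives E_X S = S E'_X. Since the dual form is h(S _, S _), its E'-derivative at U, V is the
  E-derivative of h at S U, S V, which vanishes.\<close>

lemma parallel_form_dual_form:
  assumes M: "smooth_manifold A" and g: "riemannian_metric A g"
    and E: "\<And>X Y. X \<in> smooth_vfields A \<Longrightarrow> Y \<in> smooth_vfields A \<Longrightarrow> E X Y \<in> smooth_vfields A"
    and E': "\<And>X Y. X \<in> smooth_vfields A \<Longrightarrow> Y \<in> smooth_vfields A \<Longrightarrow> E' X Y \<in> smooth_vfields A"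
    and dual: "dual_connections A g E E'"
    and h: "smooth_sym_form A h" "nondegenerate A h" "parallel_form A E h"
  shows "parallel_form A E' (dual_form A g h)"
proof -
  have gs: "smooth_sym_form A g" and gn: "nondegenerate A g"
    using g riemannian_metric_nondegenerate by (auto simp: riemannian_metric_def)
  define S where "S U = (\<lambda>p. sharp A h p (g p (U p)))" for U
  have S: "S U \<in> smooth_vfields A" if "U \<in> smooth_vfields A" for U
    unfolding S_def by (rule sharp_smooth_vfield[OF M h(1,2) gs that])
  have T: "U p \<in> tangent_space A p" if "U \<in> smooth_vfields A" for U p
    using that by (simp add: smooth_vfields_def)
  have Sh: "h p (S U p) w = g p (U p) w" if "U \<in> smooth_vfields A" "w \<in> tangent_space A p" for U p w
    unfolding S_def
    by (rule sharp_form(2)[OF M h(1,2) gs T[OF that(1)] that(2)])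
  have Sdual: "dual_form A g h p (U p) v = g p (S U p) v" for U p v
    by (simp add: dual_form_def S_def)
  note g_sym = smooth_sym_form_sym[OF gs] and h_sym = smooth_sym_form_sym[OF h(1)]
  have h_par: "vf_apply A X (\<lambda>q. h q (Y q) (Z q)) p = h p (E X Y p) (Z p) + h p (Y p) (E X Z p)"
    if "X \<in> smooth_vfields A" "Y \<in> smooth_vfields A" "Z \<in> smooth_vfields A" for X Y Z p
    using h(3) that by (auto simp: parallel_form_def form_cov_deriv_def algebra_simps)
  have comm: "h p (E X (S U) p) w = g p (E' X U p) w"
    if X: "X \<in> smooth_vfields A" and U: "U \<in> smooth_vfields A" and w: "w \<in> tangent_space A p" for X U p w
  proof -
    note SU = S[OF U]
    have field: "g q (E' X U q) (W q) = h q (E X (S U) q) (W q)" if W: "W \<in> smooth_vfields A" for W q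
    proof -
      have "vf_apply A X (\<lambda>q. g q (W q) (U q)) q = vf_apply A X (\<lambda>q. h q (S U q) (W q)) q"
        using Sh[OF U T[OF W]] g_sym[OF T[OF U] T[OF W]] by simp
      then have "g q (E X W q) (U q) + g q (W q) (E' X U q) =
          h q (E X (S U) q) (W q) + h q (S U q) (E X W q)"
        using dual X W U h_par[OF X SU W] by (simp add: dual_connections_def)
      \<comment> \<open>The terms in which W is differentiated cancel, because S U represents g(U,
        _) with respect to h.\<close>
      moreover have "g q (E X W q) (U q) = h q (S U q) (E X W q)"
        using Sh[OF U T[OF E[OF X W]]] g_sym[OF T[OF U] T[OF E[OF X W]]] by simp
      ultimately show ?thesis
        using g_sym[OF T[OF W] T[OF E'[OF X U]]] by simp
    qed
    (* Q = K (E X (S U)) is a global field, so the difference W of the two fields to be compared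
       can itself be used as a test field; positivity of g then gives W = 0. *)
    define Q where "Q = (\<lambda>p. sharp A g p (h p (E X (S U) p)))"
    have Q: "Q \<in> smooth_vfields A"
      unfolding Q_def by (rule sharp_smooth_vfield[OF M gs gn h(1) E[OF X SU]])
    have gQ: "g q (Q q) w = h q (E X (S U) q) w" if "w \<in> tangent_space A q" for q w
      unfolding Q_def
      by (rule sharp_form(2)[OF M gs gn h(1) T[OF E[OF X SU]] that])
    define W where "W = (\<lambda>p c. 1 *\<^sub>R E' X U p c + (- 1) *\<^sub>R Q p c)"
    have W: "W \<in> smooth_vfields A"
      unfolding W_def by (rule smooth_vfields_linear_combination[OF M E'[OF X U] Q])
    have gW: "g p (W p) w = g p (E' X U p) w - g p (Q p) w" if "w \<in> tangent_space A p" for w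
      unfolding W_def
      using smooth_sym_form_left[OF gs T[OF E'[OF X U]] T[OF Q] that, of 1 "- 1"] by simp
    have "g p (W p) (W p) = 0"
      using gW[OF T[OF W]] field[OF W] gQ[OF T[OF W]] by simp
    then have "W p = (\<lambda>_. 0)"
      using g T[OF W, of p] unfolding riemannian_metric_def by (metis less_irrefl)
    then have "g p (W p) w = 0"
      using smooth_sym_form_left[OF gs w w w, of 0 0] by simp
    then show ?thesis using gW[OF w] gQ[OF w] by simp
  qed
  show ?thesis
    unfolding parallel_form_def
  proof (intro ballI allI)
    fix X U V p
    assume X: "X \<in> smooth_vfields A" and U: "U \<in> smooth_vfields A" and V: "V \<in> smooth_vfields A"
    \<comment> \<open>Both sides represent the functional g(E' X Y, _) with respect to h, so
      nondegeneracy identifies them.\<close>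
    have comm': "S (E' X Y) p = E X (S Y) p" if Y: "Y \<in> smooth_vfields A" for Y
      using Sh[OF E'[OF X Y], of _ p] comm[OF X Y, of _ p]
      by (intro nondegenerate_eqI[OF M h(1,2) T[OF S[OF E'[OF X Y]]] T[OF E[OF X S[OF Y]]]]) auto
    have form: "dual_form A g h q (Y q) (Z q) = h q (S Y q) (S Z q)"
      if Y: "Y \<in> smooth_vfields A" and Z: "Z \<in> smooth_vfields A" for Y Z q
      using Sh[OF Z T[OF S[OF Y]]] g_sym[OF T[OF S[OF Y]] T[OF Z]]
        h_sym[OF T[OF S[OF Y]] T[OF S[OF Z]]] by (simp add: Sdual)
    show "form_cov_deriv A E' (dual_form A g h) X U V p = 0"
      using h_par[OF X S[OF U] S[OF V], of p]
      by (simp add: form_cov_deriv_def form U V E' X comm')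
  qed
qed

lemma regularly_metric_dual:
  assumes "smooth_manifold A" "riemannian_metric A g"
    and "\<And>X Y. X \<in> smooth_vfields A \<Longrightarrow> Y \<in> smooth_vfields A \<Longrightarrow> E X Y \<in> smooth_vfields A"
    and "\<And>X Y. X \<in> smooth_vfields A \<Longrightarrow> Y \<in> smooth_vfields A \<Longrightarrow> E' X Y \<in> smooth_vfields A"
    and "dual_connections A g E E'" "regularly_metric A E"
  shows "regularly_metric A E'"
proof -
  obtain h where h: "smooth_sym_form A h" "nondegenerate A h" "parallel_form A E h"
    using assms(6) by (auto simp: regularly_metric_def)
  have g: "smooth_sym_form A g" "nondegenerate A g"
    using assms(2) riemannian_metric_nondegenerate by (auto simp: riemannian_metric_def)
  show ?thesis
    unfolding regularly_metric_def
    using smooth_sym_form_dual_form[OF assms(1) h(1,2) g] nondegenerate_dual_form[OF assms(1) h(1,2) g]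
      parallel_form_dual_form[OF assms(1-5) h] by blast
qed

section \<open>Duality within the family of \<alpha>-connections\<close>

lemma alpha_connection_smooth:
  assumes "statistical_manifold A g D D'" "X \<in> smooth_vfields A" "Y \<in> smooth_vfields A"
  shows "alpha_connection D D' \<alpha> X Y \<in> smooth_vfields A"
  using assms smooth_vfields_linear_combination[of A "D X Y" "D' X Y"]
  by (simp add: statistical_manifold_def linear_connection_def alpha_connection_def
      vf_add_def vf_scale_def)

text \<open>By symmetry of g the pair (D', D) is dual as well. The claim is the sum of the two
  duality identities with weights (1 + \<alpha>)/2 and (1 - \<alpha>)/2; the sign change in the
  second connection matches the weights swapped by duality.\<close>

lemma alpha_connection_dual:
  assumes SM: "statistical_manifold A g D D'"
  shows "dual_connections A g (alpha_connection D D' \<alpha>) (alpha_connection D D' (- \<alpha>))"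
  unfolding dual_connections_def
proof (intro ballI allI)
  fix X Y Z p
  assume X: "X \<in> smooth_vfields A" and Y: "Y \<in> smooth_vfields A" and Z: "Z \<in> smooth_vfields A"
  have M: "smooth_manifold A" and gs: "smooth_sym_form A g" and dual: "dual_connections A g D D'"
    using SM by (auto simp: statistical_manifold_def riemannian_metric_def)
  have T: "U q \<in> tangent_space A q" if "U \<in> smooth_vfields A" for U q
    using that by (simp add: smooth_vfields_def)
  have D: "D X U p \<in> tangent_space A p" "D' X U p \<in> tangent_space A p"
    if "U \<in> smooth_vfields A" for U
    using SM X that by (auto simp: statistical_manifold_def linear_connection_def intro!: T)
  note sym = smooth_sym_form_sym[OF gs]
  have 1: "vf_apply A X (\<lambda>q. g q (Y q) (Z q)) p = g p (D X Y p) (Z p) + g p (Y p) (D' X Z p)"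
    using dual X Y Z by (simp add: dual_connections_def)
  have "vf_apply A X (\<lambda>q. g q (Z q) (Y q)) p = g p (D X Z p) (Y p) + g p (Z p) (D' X Y p)"
    using dual X Y Z by (simp add: dual_connections_def)
  then have 2: "vf_apply A X (\<lambda>q. g q (Y q) (Z q)) p = g p (D' X Y p) (Z p) + g p (Y p) (D X Z p)"
    by (simp add: sym[OF T[OF Z] T[OF Y]] sym[OF D(1)[OF Z] T[OF Y]] sym[OF T[OF Z] D(2)[OF Y]])
  have "g p (alpha_connection D D' \<alpha> X Y p) (Z p) =
      (1 + \<alpha>) / 2 * g p (D X Y p) (Z p) + (1 - \<alpha>) / 2 * g p (D' X Y p) (Z p)"
    using smooth_sym_form_left[OF gs D(1)[OF Y] D(2)[OF Y] T[OF Z]]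
    by (simp add: alpha_connection_def vf_add_def vf_scale_def)
  moreover have "g p (Y p) (alpha_connection D D' (- \<alpha>) X Z p) =
      (1 - \<alpha>) / 2 * g p (Y p) (D X Z p) + (1 + \<alpha>) / 2 * g p (Y p) (D' X Z p)"
    using smooth_sym_form_right[OF M gs D(1)[OF Z] D(2)[OF Z] T[OF Y]]
    by (simp add: alpha_connection_def vf_add_def vf_scale_def)
  \<comment> \<open>The weights sum to 1, so the derivative can be divided between its two
    expressions.\<close>
  moreover have split: "t = (1 + \<alpha>) / 2 * t + (1 - \<alpha>) / 2 * t" for t :: real
    by (simp add: field_simps)
  from split[of "vf_apply A X (\<lambda>q. g q (Y q) (Z q)) p"]
  have "vf_apply A X (\<lambda>q. g q (Y q) (Z q)) p =
      (1 + \<alpha>) / 2 * (g p (D X Y p) (Z p) + g p (Y p) (D' X Z p))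
      + (1 - \<alpha>) / 2 * (g p (D' X Y p) (Z p) + g p (Y p) (D X Z p))"
    unfolding 1[symmetric] 2[symmetric] .
  ultimately show "vf_apply A X (\<lambda>q. g q (Y q) (Z q)) p =
      g p (alpha_connection D D' \<alpha> X Y p) (Z p) + g p (Y p) (alpha_connection D D' (- \<alpha>) X Z p)"
    by (simp only: distrib_left add_ac)
qed

theorem theorem4:
  fixes A :: "('m::{t2_space, second_countable_topology}, 'e::real_inner) chart set"
    and g :: "('m, 'e) tform"
    and D D' :: "('m, 'e) conn"
  assumes "statistical_manifold A g D D'"
    and "\<And>\<alpha>::real. \<alpha> > 0 \<Longrightarrow> regularly_metric A (alpha_connection D D' \<alpha>)"
  shows "\<forall>\<alpha>::real. regularly_metric A (alpha_connection D D' \<alpha>)"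
proof
  fix \<alpha> :: real
  have M: "smooth_manifold A" and g: "riemannian_metric A g"
    using assms(1) by (auto simp: statistical_manifold_def)
  consider "\<alpha> > 0" | "\<alpha> = 0" | "\<alpha> < 0" by linarith
  then show "regularly_metric A (alpha_connection D D' \<alpha>)"
  proof cases
    case 1
    then show ?thesis by (rule assms(2))
  next
    case 2
    \<comment> \<open>Since 0 = -0, this connection is dual to itself, and self-duality is
      parallelism of g.\<close>
    have "parallel_form A (alpha_connection D D' 0) g"
      using alpha_connection_dual[OF assms(1), of 0]
      by (simp add: dual_connections_def parallel_form_def form_cov_deriv_def)
    then show ?thesis
      using g riemannian_metric_nondegenerate[OF g] 2
      unfolding regularly_metric_def riemannian_metric_def by blast
  next
    case 3
    then have "regularly_metric A (alpha_connection D D' (- \<alpha>))" by (intro assms(2)) simp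
    with alpha_connection_dual[OF assms(1), of "- \<alpha>"] show ?thesis
      using regularly_metric_dual[OF M g alpha_connection_smooth[OF assms(1)]
          alpha_connection_smooth[OF assms(1)]] by simp
  qed
qed

end
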